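(* Let $d\ge 2$ be fixed. There is a constant $C_d$ (depending only on $d$) such that for every positive integer $n$ there exists an $n$-point set $S\subset\mathbb{R}^d$ in convex position such that every point $p\in\mathbb{R}^d$ is contained in at most $\left(\frac{n}{d+1}\right)^{d+1}+C_d\, n^{d}$ of the $d$-simplices spanned by $S$.
   Context: A $d$-simplex spanned by $S$ is the convex hull of a $(d+1)$-element subset of $S$; a point $p$ is contained in it if $p$ belongs to this (closed) convex hull. The count is over $(d+1)$-element subsets of $S$. A finite set is in convex position if no point of it lies in the convex hull of the others. *)

theory Defs
  imports "HOL-Analysis.Analysis"
begin

definition in_convex_position :: "'a::real_vector set \<Rightarrow> bool" where
  "in_convex_position S \<longleftrightarrow> (\<forall>x\<in>S. x \<notin> convex hull (S - {x}))"

definition simplex_depth :: "nat \<Rightarrow> 'a::real_vector set \<Rightarrow> 'a \<Rightarrow> nat" where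
  "simplex_depth d S p = card {T. T \<subseteq> S \<and> card T = d + 1 \<and> p \<in> convex hull T}"

end

theory Submission
  imports Defs
begin

text \<open>
  Take the \<open>n\<close> points \<open>(K\<^sub>1^t, \<dots>, K\<^sub>d^t)\<close>, \<open>t < n\<close>, where each \<open>K\<^sub>i\<close> is huge compared with
  \<open>K\<^sub>j^n\<close> for \<open>j < i\<close>. Given \<open>p\<close>, let \<open>s\<^sub>i\<close> be such that \<open>K\<^sub>i^s\<^sub>i \<le> p\<^sub>i < K\<^sub>i^(s\<^sub>i + 1)\<close>. An index \<open>t\<close> has
  type \<open>j\<close> if \<open>j\<close> is the last coordinate with \<open>s\<^sub>j < t\<close>, and type \<open>0\<close> if there is none. Leaving aside
  the at most \<open>2d\<close> indices of the form \<open>s\<^sub>i\<close> or \<open>s\<^sub>i + 1\<close>, a simplex containing \<open>p\<close> must have one vertex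
  of each of the \<open>d + 1\<close> types, since otherwise an explicit hyperplane separates it from \<open>p\<close>. By
  AM-GM there are at most \<open>(n/(d+1))^(d+1)\<close> such simplices, and those using an exceptional index
  number at most \<open>2d n^d\<close>.
\<close>

subsection \<open>Counting transversals\<close>

text \<open>The classes are disjoint and \<open>U\<close> has as many elements as there are classes,
  so \<open>U\<close> is the range of a choice function for \<open>N\<close>. The number of choice
  functions is the product of the class sizes, and AM-GM bounds it.\<close>

lemma card_transversals_le:
  fixes N :: "'k::finite \<Rightarrow> 'a set"
  assumes "finite A" and N: "\<And>k. N k \<subseteq> A" and disj: "\<And>k l. k \<noteq> l \<Longrightarrow> N k \<inter> N l = {}"
  shows "real (card {U. U \<subseteq> A \<and> card U = CARD('k) \<and> (\<forall>k. U \<inter> N k \<noteq> {})})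
    \<le> (real (card A) / real CARD('k)) ^ CARD('k)"
proof -
  let ?F = "{U. U \<subseteq> A \<and> card U = CARD('k) \<and> (\<forall>k. U \<inter> N k \<noteq> {})}"
  have fin: "finite (N k)" for k
    using N \<open>finite A\<close> finite_subset by blast
  have sub: "?F \<subseteq> range ` (PiE UNIV N)"
  proof
    fix U assume U: "U \<in> ?F"
    then have "\<forall>k. \<exists>u. u \<in> U \<inter> N k" by blast
    then obtain g where g: "\<And>k. g k \<in> U \<inter> N k" by metis
    have "inj g"
      using g disj by (metis IntD2 disjoint_iff injI)
    then have "card (range g) = card U"
      using U by (simp add: card_image)
    moreover have "range g \<subseteq> U" "finite U"
      using g U \<open>finite A\<close> finite_subset by auto
    ultimately have "range g = U"
      by (simp add: card_subset_eq)
    then show "U \<in> range ` (PiE UNIV N)"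
      using g by (intro image_eqI[of _ _ g]) auto
  qed
  have finP: "finite (PiE UNIV N)"
    using fin by (intro finite_PiE) auto
  have "card ?F \<le> card (PiE UNIV N)"
    using card_mono[OF finite_imageI[OF finP] sub] card_image_le[OF finP, of range] by linarith
  also have "\<dots> = (\<Prod>k\<in>UNIV. card (N k))"
    by (simp add: card_PiE)
  finally have 1: "real (card ?F) \<le> (\<Prod>k\<in>UNIV. real (card (N k)))"
    by (simp only: of_nat_prod[symmetric] of_nat_le_iff)
  let ?P = "\<Prod>k\<in>UNIV. real (card (N k))"
  have P: "?P \<ge> 0"
    by (simp add: prod_nonneg)
  have "?P powr (1 / CARD('k)) \<le> (\<Sum>k\<in>UNIV. real (card (N k)) / real CARD('k))"
    by (rule arith_geom_mean) auto
  then have "(?P powr (1 / CARD('k))) ^ CARD('k) \<le> (\<Sum>k\<in>UNIV. real (card (N k)) / real CARD('k)) ^ CARD('k)"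
    by (rule power_mono) simp
  moreover have "(?P powr (1 / CARD('k))) ^ CARD('k) = ?P"
    using P by (cases "?P = 0") (auto simp: powr_power simp del: prod_zero_iff)
  ultimately have "?P \<le> (\<Sum>k\<in>UNIV. real (card (N k)) / real CARD('k)) ^ CARD('k)"
    by linarith
  moreover have "(\<Sum>k\<in>UNIV. real (card (N k)) / real CARD('k)) \<le> real (card A) / real CARD('k)"
  proof -
    have "(\<Sum>k\<in>UNIV. card (N k)) = card (\<Union>k. N k)"
      using fin disj by (subst card_UN_disjoint) auto
    also have "\<dots> \<le> card A"
      using N \<open>finite A\<close> by (intro card_mono) auto
    finally have "(\<Sum>k\<in>UNIV. real (card (N k))) \<le> real (card A)"
      by (simp only: of_nat_sum[symmetric] of_nat_le_iff)
    then show ?thesis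
      by (simp add: sum_divide_distrib[symmetric] divide_right_mono)
  qed
  then have "(\<Sum>k\<in>UNIV. real (card (N k)) / real CARD('k)) ^ CARD('k)
      \<le> (real (card A) / real CARD('k)) ^ CARD('k)"
    by (intro power_mono sum_nonneg) auto
  ultimately show ?thesis
    using 1 by linarith
qed

text \<open>Union bound: pick an element of \<open>E\<close>, then the other \<open>m\<close>
  elements. It will control the simplices with an exceptional vertex.\<close>

lemma card_subsets_meeting_le:
  assumes "finite A" "finite E"
  shows "card {U. U \<subseteq> A \<and> card U = Suc m \<and> U \<inter> E \<noteq> {}} \<le> card E * card A ^ m"
proof -
  let ?V = "{V. V \<subseteq> A \<and> card V = m}"
  have finV: "finite ?V" using assms by simp
  have "{U. U \<subseteq> A \<and> card U = Suc m \<and> U \<inter> E \<noteq> {}} \<subseteq> (\<Union>e\<in>E. insert e ` ?V)"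
  proof
    fix U assume U: "U \<in> {U. U \<subseteq> A \<and> card U = Suc m \<and> U \<inter> E \<noteq> {}}"
    then obtain e where e: "e \<in> U" "e \<in> E" by auto
    have "U - {e} \<in> ?V" "U = insert e (U - {e})"
      using U e by auto
    then show "U \<in> (\<Union>e\<in>E. insert e ` ?V)"
      using e by blast
  qed
  then have "card {U. U \<subseteq> A \<and> card U = Suc m \<and> U \<inter> E \<noteq> {}} \<le> card (\<Union>e\<in>E. insert e ` ?V)"
    using finV assms by (intro card_mono) auto
  also have "\<dots> \<le> (\<Sum>e\<in>E. card (insert e ` ?V))"
    using assms by (intro card_UN_le) auto
  also have "\<dots> \<le> (\<Sum>e\<in>E. card A ^ m)"
  proof (rule sum_mono)
    fix e
    have "card (insert e ` ?V) \<le> card ?V"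
      using finV by (rule card_image_le)
    also have "\<dots> = card A choose m"
      using assms by (simp add: n_subsets)
    also have "\<dots> \<le> card A ^ m"
      by (cases "m \<le> card A") (auto intro: binomial_le_pow simp: binomial_eq_0)
    finally show "card (insert e ` ?V) \<le> card A ^ m" .
  qed
  finally show ?thesis by simp
qed

subsection \<open>The stretched diagonal\<close>

definition stretched_point :: "('d \<Rightarrow> real) \<Rightarrow> nat \<Rightarrow> real^'d" where
  "stretched_point K t = (\<chi> i. K i ^ t)"

lemma stretched_point_nth [simp]: "stretched_point K t $ i = K i ^ t"
  by (simp add: stretched_point_def)

lemma inj_stretched_point:
  assumes "K i > 1"
  shows "inj (stretched_point K)"
  using assms by (metis injI power_inject_exp stretched_point_nth)

text \<open>Open half-spaces are convex. Each separation below picks \<open>c\<close> as a lower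
  bound for the functional at \<open>p\<close> and thereby reaches a contradiction.\<close>

lemma convex_hull_linear_less:
  fixes p :: "real^'d"
  assumes "p \<in> convex hull T" and "\<And>x. x \<in> T \<Longrightarrow> (\<Sum>i\<in>UNIV. a i * x $ i) < c"
  shows "(\<Sum>i\<in>UNIV. a i * p $ i) < c"
proof -
  have eq: "(\<chi> i. a i) \<bullet> x = (\<Sum>i\<in>UNIV. a i * x $ i)" for x :: "real^'d"
    by (simp add: inner_vec_def)
  have "convex hull T \<subseteq> {x. (\<chi> i. a i) \<bullet> x < c}"
    using assms(2) by (intro hull_minimal convex_halfspace_lt) (auto simp: eq)
  then show ?thesis
    using assms(1) by (auto simp: eq)
qed

text \<open>Two coordinates suffice: the functional
  \<open>2 * x $ i / K i ^ t - x $ j / K j ^ t\<close> is 1 at the point with index \<open>t\<close>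
  and less than 1 at the others. For smaller indices its first term is already below 1; for larger
  ones its second term dominates.\<close>

lemma in_convex_position_stretched:
  fixes K :: "'d::finite \<Rightarrow> real"
  assumes "K i > 2" "2 * K i \<le> K j"
  shows "in_convex_position (stretched_point K ` A)"
  unfolding in_convex_position_def
proof (intro ballI notI)
  fix x assume "x \<in> stretched_point K ` A"
    and hull: "x \<in> convex hull (stretched_point K ` A - {x})"
  then obtain t where t: "x = stretched_point K t" by auto
  have ij: "i \<noteq> j" using assms by auto
  define a where "a = (\<lambda>l. if l = i then 2 / K i ^ t else if l = j then - 1 / K j ^ t else 0)"
  have a: "(\<Sum>l\<in>UNIV. a l * y $ l) = 2 * (y $ i / K i ^ t) - y $ j / K j ^ t" for y :: "real^'d"
  proof -
    have "(\<Sum>l\<in>UNIV. a l * y $ l) = (\<Sum>l\<in>{i, j}. a l * y $ l)"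
      by (rule sum.mono_neutral_right) (auto simp: a_def)
    then show ?thesis using ij by (simp add: a_def)
  qed
  have pos: "K i ^ t > 0" "K j ^ t > 0" using assms by auto
  have "(\<Sum>l\<in>UNIV. a l * x $ l) < 1"
  proof (rule convex_hull_linear_less[OF hull])
    fix y assume y: "y \<in> stretched_point K ` A - {x}"
    then obtain u where u: "y = stretched_point K u" "u \<noteq> t" using t by auto
    show "(\<Sum>l\<in>UNIV. a l * y $ l) < 1"
    proof (cases "u < t")
      case True
      then have "K i ^ Suc u \<le> K i ^ t" using assms by (intro power_increasing) auto
      moreover have "2 * K i ^ u < K i ^ Suc u" using assms by simp
      ultimately have "2 * (K i ^ u / K i ^ t) < 1"
        using pos by (simp add: divide_simps)
      moreover have "K j ^ u / K j ^ t > 0" using assms by auto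
      ultimately show ?thesis unfolding a by (simp add: u)
    next
      case False
      then obtain r where r: "u = t + Suc r" using u(2)
        by (metis add_Suc_right less_imp_Suc_add linorder_neqE_nat)
      \<comment> \<open>After division by the powers with exponent \<open>t\<close>, only powers
        with the positive exponent \<open>Suc r\<close> remain, so one factor 2 between
        \<open>K i\<close> and \<open>K j\<close> is enough.\<close>
      have "2 * K i ^ Suc r \<le> 2 ^ Suc r * K i ^ Suc r"
        using assms by (intro mult_right_mono) auto
      also have "\<dots> = (2 * K i) ^ Suc r" by (rule power_mult_distrib[symmetric])
      also have "\<dots> \<le> K j ^ Suc r" using assms by (intro power_mono) auto
      finally have "2 * (K i ^ u / K i ^ t) \<le> K j ^ u / K j ^ t"
        using assms by (simp add: r power_add)
      then show ?thesis unfolding a by (simp add: u)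
    qed
  qed
  then show False using assms unfolding a by (simp add: t split: if_splits)
qed

section \<open>Index types and separating hyperplanes\<close>

text \<open>The injection \<open>h\<close> orders the coordinates by growth, so "last" means largest
  \<open>h\<close>. Type 0 is \<open>None\<close>, which makes \<open>'d option\<close> the set of
  all \<open>d + 1\<close> types.\<close>

definition index_type :: "nat \<Rightarrow> ('d \<Rightarrow> nat) \<Rightarrow> ('d \<Rightarrow> nat) \<Rightarrow> 'd option \<Rightarrow> nat set" where
  "index_type n h s k = (case k of
      None \<Rightarrow> {t. t < n \<and> (\<forall>i. t \<le> s i)}
    | Some j \<Rightarrow> {t. t < n \<and> s j < t \<and> (\<forall>i. h j < h i \<longrightarrow> t \<le> s i)})"

lemma index_type_subset: "index_type n h s k \<subseteq> {..<n}"
  by (auto simp: index_type_def split: option.splits)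

lemma index_type_disjoint:
  assumes "inj h" "k \<noteq> l"
  shows "index_type n h s k \<inter> index_type n h s l = {}"
proof -
  have Some: "t \<notin> index_type n h s (Some j) \<or> t \<notin> index_type n h s (Some i)" if "i \<noteq> j" for i j t
  proof -
    have "h i < h j \<or> h j < h i"
      using assms(1) that by (metis injD linorder_neqE_nat)
    then show ?thesis by (auto simp: index_type_def not_less)
  qed
  have None: "t \<notin> index_type n h s (Some j) \<or> t \<notin> index_type n h s None" for j t
    by (auto simp: index_type_def not_less)
  show ?thesis
    using assms(2) Some None by (metis disjoint_iff option.exhaust)
qed

text \<open>If a type is missing, a functional in the ratios \<open>x $ i / p $ i\<close> separates
  \<open>p\<close> from all vertices. Away from the exceptional indices each such ratio is either at
  most 1/2 or larger than \<open>K i\<close>.\<close>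

lemma simplex_meets_type:
  fixes K :: "'d::finite \<Rightarrow> real" and p :: "real^'d" and h :: "'d \<Rightarrow> nat"
  assumes K: "\<And>i. K i \<ge> 2 * CARD('d)"
    and growth: "\<And>i j. h j < h i \<Longrightarrow> 2 * CARD('d) * K j ^ n \<le> K i"
    and s: "\<And>i. K i ^ s i \<le> p $ i" "\<And>i. p $ i < K i ^ Suc (s i)"
    and U: "U \<subseteq> {..<n}" "U \<inter> (range s \<union> range (Suc \<circ> s)) = {}"
    and hull: "p \<in> convex hull (stretched_point K ` U)"
  shows "U \<inter> index_type n h s k \<noteq> {}"
proof
  assume empty: "U \<inter> index_type n h s k = {}"
  let ?d = "real CARD('d)"
  have d: "?d \<ge> 1" by (simp add: Suc_leI)
  have K2: "K i \<ge> 2" for i using K[of i] d by linarith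
  have p1: "p $ i \<ge> 1" for i
    using s(1)[of i] one_le_power[of "K i" "s i"] K2[of i] by linarith
  have ppos: "p $ i > 0" for i using p1[of i] by linarith
  have Kpos: "K i ^ t > 0" for i t using K2[of i] by simp
  have small: "2 * K i ^ t \<le> p $ i" if "t < s i" for i t
  proof -
    have "2 * K i ^ t \<le> K i ^ Suc t" using K2[of i] Kpos[of i t] by simp
    also have "\<dots> \<le> K i ^ s i" using that K2[of i] by (intro power_increasing) auto
    finally show ?thesis using s(1)[of i] by linarith
  qed
  \<comment> \<open>Excluding \<open>Suc (s i)\<close> leaves a full power of \<open>K i\<close>
    between \<open>p $ i\<close> and \<open>K i ^ t\<close>.\<close>
  have large: "K i * p $ i < K i ^ t" if "t > s i" "t \<in> U" for i t
  proof -
    have "t \<noteq> Suc (s i)" using that U(2) by force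
    then have t: "Suc (Suc (s i)) \<le> t" using that by simp
    have "K i * p $ i < K i * K i ^ Suc (s i)" using s(2)[of i] K2[of i] by simp
    also have "\<dots> \<le> K i ^ t" using power_increasing[OF t, of "K i"] K2[of i] by simp
    finally show ?thesis .
  qed
  have strict: "t < s i \<or> s i < t" if "t \<in> U" for i t
    using that U(2) by (metis Int_iff UnI1 emptyE linorder_neqE_nat rangeI)
  show False
  proof (cases k)
    case None
    \<comment> \<open>The ratios sum to exactly \<open>?d\<close> at \<open>p\<close>, but to more
      at every vertex, where some ratio exceeds \<open>K i\<close>.\<close>
    have "(\<Sum>i\<in>UNIV. (- 1 / p $ i) * p $ i) < - ?d"
    proof (rule convex_hull_linear_less[OF hull])
      fix x assume "x \<in> stretched_point K ` U"
      then obtain t where t: "t \<in> U" "x = stretched_point K t" by auto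
      then have "t \<notin> index_type n h s k" "t < n"
        using empty U(1) by auto
      then obtain i where i: "s i < t"
        by (auto simp: None index_type_def not_le)
      have "?d < K i" using K[of i] d by linarith
      also have "K i < K i ^ t / p $ i"
        using large[OF i t(1)] ppos[of i] by (simp add: field_simps)
      also have "\<dots> \<le> (\<Sum>l\<in>UNIV. K l ^ t / p $ l)"
        using Kpos ppos by (intro member_le_sum) (auto intro: less_imp_le)
      finally show "(\<Sum>l\<in>UNIV. (- 1 / p $ l) * x $ l) < - ?d"
        by (simp add: t sum_negf)
    qed
    moreover have "(- 1 / p $ i) * p $ i = - 1" for i using ppos[of i] by simp
    ultimately show False by simp
  next
    case (Some j)
    define R where "R = {i. h j < h i}"
    have jR: "j \<notin> R" by (simp add: R_def)
    \<comment> \<open>The weight \<open>1 / (2 * ?d)\<close> makes the later coordinates cost less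
      than 1/2 at \<open>p\<close>, so the functional exceeds 1/2 there; at the vertices it is at
      most 1/2.\<close>
    define a where "a = (\<lambda>i. if i = j then 1 / p $ j else if i \<in> R then - 1 / (2 * ?d * p $ i) else 0)"
    have a: "(\<Sum>i\<in>UNIV. a i * y $ i) = y $ j / p $ j - (\<Sum>i\<in>R. y $ i / p $ i) / (2 * ?d)" for y :: "real^'d"
    proof -
      have "(\<Sum>i\<in>UNIV. a i * y $ i) = (\<Sum>i\<in>insert j R. a i * y $ i)"
        by (rule sum.mono_neutral_right) (auto simp: a_def)
      also have "\<dots> = y $ j / p $ j + (\<Sum>i\<in>R. - (y $ i / p $ i / (2 * ?d)))"
        using jR by (auto simp: a_def field_simps intro!: sum.cong)
      finally show ?thesis by (simp add: sum_negf sum_divide_distrib)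
    qed
    have Rn: "real (card R) / (2 * ?d) < 1 / 2"
    proof -
      have "card R < CARD('d)" using jR by (intro psubset_card_mono) auto
      then show ?thesis using d by (simp add: field_simps)
    qed
    have "(\<Sum>i\<in>UNIV. a i * p $ i) < 1 - real (card R) / (2 * ?d)"
    proof (rule convex_hull_linear_less[OF hull])
      fix x assume "x \<in> stretched_point K ` U"
      then obtain t where t: "t \<in> U" "x = stretched_point K t" by auto
      have nn: "0 \<le> K i ^ t / p $ i" for i
        using Kpos[of i t] ppos[of i] by simp
      have "(\<Sum>i\<in>UNIV. a i * x $ i) \<le> 1 / 2"
      proof (cases "\<exists>i\<in>R. s i < t")
        case True
        \<comment> \<open>Here a later coordinate overwhelms coordinate \<open>j\<close>: as
          \<open>t < n\<close>, the growth condition makes the functional nonpositive.\<close>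
        then obtain i where i: "h j < h i" "s i < t" "i \<in> R" by (auto simp: R_def)
        have "K j ^ t \<le> K j ^ n"
          using t(1) U(1) K2[of j] by (intro power_increasing) auto
        moreover have "K j ^ t / p $ j \<le> K j ^ t"
          using p1[of j] Kpos[of j t] by (simp add: field_simps)
        moreover have "K j ^ n \<le> K i / (2 * ?d)"
          using growth[OF i(1)] d by (simp add: field_simps)
        moreover have "K i \<le> K i ^ t / p $ i"
          using large[OF i(2) t(1)] ppos[of i] by (simp add: field_simps)
        moreover have "K i ^ t / p $ i \<le> (\<Sum>l\<in>R. K l ^ t / p $ l)"
          using i nn by (intro member_le_sum) auto
        ultimately have "K j ^ t / p $ j \<le> K i / (2 * ?d)" "K i \<le> (\<Sum>l\<in>R. K l ^ t / p $ l)"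
          by linarith+
        then have "K j ^ t / p $ j \<le> (\<Sum>l\<in>R. K l ^ t / p $ l) / (2 * ?d)"
          using d by (meson divide_right_mono mult_nonneg_nonneg of_nat_0_le_iff order_trans zero_le_numeral)
        then show ?thesis unfolding a unfolding t(2) stretched_point_nth by linarith
      next
        case False
        then have "\<forall>i. h j < h i \<longrightarrow> t \<le> s i" by (metis R_def mem_Collect_eq not_le)
        moreover have "t \<notin> index_type n h s k" "t < n"
          using empty t(1) U(1) by auto
        ultimately have "\<not> s j < t"
          by (simp add: Some index_type_def)
        \<comment> \<open>Equality is impossible because \<open>s j\<close> is an exceptional
          index.\<close>
        then have "t < s j" using strict[OF t(1)] by blast
        then have "K j ^ t / p $ j \<le> 1 / 2"
          using small ppos[of j] by (simp add: field_simps)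
        moreover have "(\<Sum>i\<in>R. K i ^ t / p $ i) / (2 * ?d) \<ge> 0"
          by (intro divide_nonneg_nonneg[OF sum_nonneg] nn) simp
        ultimately show ?thesis unfolding a unfolding t(2) stretched_point_nth by linarith
      qed
      then show "(\<Sum>i\<in>UNIV. a i * x $ i) < 1 - real (card R) / (2 * ?d)"
        using Rn by linarith
    qed
    moreover have "p $ i / p $ i = 1" for i using ppos[of i] by simp
    ultimately show False unfolding a by simp
  qed
qed

section \<open>The depth bound\<close>

lemma simplex_depth_image:
  assumes "inj f" "finite A"
  shows "simplex_depth d (f ` A) p = card {U. U \<subseteq> A \<and> card U = Suc d \<and> p \<in> convex hull (f ` U)}"
proof -
  have "{T. T \<subseteq> f ` A \<and> card T = d + 1 \<and> p \<in> convex hull T}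
      = image f ` {U. U \<subseteq> A \<and> card U = Suc d \<and> p \<in> convex hull (f ` U)}" (is "?L = ?R")
  proof
    show "?L \<subseteq> ?R"
    proof
      fix T assume T: "T \<in> ?L"
      then obtain U where "U \<subseteq> A" "T = f ` U" by (auto simp: subset_image_iff)
      moreover have "card (f ` U) = card U"
        using assms(1) by (meson card_image inj_on_subset subset_UNIV)
      ultimately show "T \<in> ?R" using T by auto
    qed
    show "?R \<subseteq> ?L"
      using assms(1) by (auto simp: card_image inj_on_subset)
  qed
  moreover have "inj (image f)" using assms(1) by (simp add: inj_image_eq_iff inj_def)
  ultimately show ?thesis
    unfolding simplex_depth_def by (metis (no_types, lifting) card_image inj_on_subset subset_UNIV)
qed

lemma ex_power_bracket:
  fixes b x :: real
  assumes "b > 1" "x \<ge> 1"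
  shows "\<exists>s. b ^ s \<le> x \<and> x < b ^ Suc s"
proof -
  obtain m where m: "x < b ^ m" using real_arch_pow assms(1) by blast
  define l where "l = (LEAST m. x < b ^ m)"
  have l: "x < b ^ l" unfolding l_def using m by (rule LeastI)
  then obtain s where s: "l = Suc s" using assms(2) by (cases l) auto
  then have "\<not> x < b ^ s" using not_less_Least[of s "\<lambda>m. x < b ^ m"] by (simp add: l_def)
  then show ?thesis using l s by (intro exI[of _ s]) auto
qed

lemma simplex_depth_stretched_le:
  fixes K :: "'d::finite \<Rightarrow> real" and p :: "real^'d" and h :: "'d \<Rightarrow> nat"
  assumes K: "\<And>i. K i \<ge> 2 * CARD('d)"
    and "inj h" and growth: "\<And>i j. h j < h i \<Longrightarrow> 2 * CARD('d) * K j ^ n \<le> K i"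
  shows "real (simplex_depth CARD('d) (stretched_point K ` {..<n}) p)
    \<le> (real n / real (CARD('d) + 1)) ^ (CARD('d) + 1) + 2 * CARD('d) * real n ^ CARD('d)"
proof -
  let ?d = "CARD('d)"
  have K1: "K i > 1" for i
  proof -
    have "real ?d \<ge> 1" by (simp add: Suc_leI)
    then show ?thesis using K[of i] by linarith
  qed
  let ?F = "{U. U \<subseteq> {..<n} \<and> card U = Suc ?d \<and> p \<in> convex hull (stretched_point K ` U)}"
  have depth: "simplex_depth ?d (stretched_point K ` {..<n}) p = card ?F"
    using inj_stretched_point[of K] K1 by (intro simplex_depth_image) auto
  show ?thesis
  proof (cases "\<exists>i. p $ i < 1")
    case True
    then obtain i where i: "p $ i < 1" by blast
    \<comment> \<open>All points of the set have coordinates at least 1, so such a \<open>p\<close>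
      has depth 0. Otherwise every \<open>p $ i\<close> lies between consecutive powers of
      \<open>K i\<close>.\<close>
    have "p \<notin> convex hull (stretched_point K ` U)" for U
    proof
      assume hull: "p \<in> convex hull (stretched_point K ` U)"
      have *: "(\<Sum>l\<in>UNIV. (if l = i then - 1 else 0) * y $ l) = - (y $ i)" for y :: "real^'d"
        by (simp add: if_distrib[of "\<lambda>c. c * _"] cong: if_cong)
      have "(\<Sum>l\<in>UNIV. (if l = i then - 1 else 0) * p $ l) < - (p $ i)"
      proof (rule convex_hull_linear_less[OF hull])
        fix y assume "y \<in> stretched_point K ` U"
        then obtain t where y: "y = stretched_point K t" by auto
        then show "(\<Sum>l\<in>UNIV. (if l = i then - 1 else 0) * y $ l) < - (p $ i)"
          unfolding * y using i one_le_power[OF less_imp_le[OF K1[of i]], of t] by simp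
      qed
      then show False by (simp only: *)
    qed
    then show ?thesis unfolding depth by simp
  next
    case False
    then have "\<forall>i. \<exists>s. K i ^ s \<le> p $ i \<and> p $ i < K i ^ Suc s"
      using ex_power_bracket K1 by (meson linorder_not_less)
    then obtain s where s: "\<And>i. K i ^ s i \<le> p $ i" "\<And>i. p $ i < K i ^ Suc (s i)"
      by metis
    define E where "E = range s \<union> range (Suc \<circ> s)"
    let ?G = "{U. U \<subseteq> {..<n} \<and> card U = CARD('d option) \<and> (\<forall>k. U \<inter> index_type n h s k \<noteq> {})}"
    let ?H = "{U. U \<subseteq> {..<n} \<and> card U = Suc ?d \<and> U \<inter> E \<noteq> {}}"
    \<comment> \<open>A simplex around \<open>p\<close> either avoids \<open>E\<close> and is a
      transversal of the types, giving the main term, or meets \<open>E\<close>, giving the error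
      term.\<close>
    have "?F \<subseteq> ?G \<union> ?H"
      using simplex_meets_type[OF K growth s] by (auto simp: E_def)
    then have "card ?F \<le> card (?G \<union> ?H)" by (intro card_mono) auto
    then have "card ?F \<le> card ?G + card ?H"
      using card_Un_le[of ?G ?H] by linarith
    moreover have "real (card ?G) \<le> (real (card {..<n}) / real CARD('d option)) ^ CARD('d option)"
      using \<open>inj h\<close> by (intro card_transversals_le index_type_subset index_type_disjoint) auto
    moreover have "card ?H \<le> 2 * ?d * n ^ ?d"
    proof -
      have "card E \<le> 2 * ?d"
        using card_Un_le[of "range s" "range (Suc \<circ> s)"] card_image_le[of UNIV s]
          card_image_le[of UNIV "Suc \<circ> s"] unfolding E_def by simp
      moreover have "card ?H \<le> card E * card {..<n} ^ ?d"
        by (rule card_subsets_meeting_le) (auto simp: E_def)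
      ultimately show ?thesis by (simp add: order_trans[OF _ mult_right_mono])
    qed
    then have "real (card ?H) \<le> 2 * ?d * real n ^ ?d"
      by (metis (mono_tags, lifting) of_nat_le_iff of_nat_mult of_nat_power of_nat_numeral)
    ultimately show ?thesis unfolding depth by (simp add: card_UNIV_option)
  qed
qed

section \<open>Choice of the parameters\<close>

theorem theorem3:
  assumes "CARD('d::finite) \<ge> 2"
  shows "\<exists>C::real. \<forall>n::nat. n > 0 \<longrightarrow>
           (\<exists>S :: (real^'d) set. finite S \<and> card S = n \<and> in_convex_position S \<and>
              (\<forall>p :: real^'d. real (simplex_depth CARD('d) S p)
                 \<le> (real n / real (CARD('d) + 1)) ^ (CARD('d) + 1) + C * real n ^ CARD('d)))"
proof (intro exI[of _ "2 * real CARD('d)"] allI impI)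
  fix n :: nat assume n: "n > 0"
  let ?d = "CARD('d)"
  define B where "B = 2 * real ?d"
  have B: "B \<ge> 4" using assms by (simp add: B_def)
  obtain h :: "'d \<Rightarrow> nat" where h: "inj h"
    using finite_imp_inj_to_nat_seg[of "UNIV :: 'd set"] by auto
  \<comment> \<open>Raising the exponent by a factor \<open>n + 1\<close> per step of
    \<open>h\<close> gives \<open>K j ^ (n + 1) \<le> K i\<close>; the spare factor
    \<open>K j \<ge> B\<close> absorbs the constant in the growth condition.\<close>
  define K where "K = (\<lambda>i. B ^ (n + 1) ^ h i)"
  have KB: "K i \<ge> B" for i
    using B power_increasing[of 1 "(n + 1) ^ h i" B] by (simp add: K_def)
  have growth: "B * K j ^ n \<le> K i" if "h j < h i" for i j
  proof -
    have "B * K j ^ n \<le> K j ^ (n + 1)"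
      using KB[of j] B by simp
    also have "\<dots> = B ^ (n + 1) ^ Suc (h j)"
      by (simp only: K_def power_mult[symmetric] power_Suc mult.commute)
    also have "\<dots> \<le> K i"
      unfolding K_def using that B by (intro power_increasing) auto
    finally show ?thesis .
  qed
  \<comment> \<open>Dimension at least 2 provides the two coordinates of different growth that
    convex position requires.\<close>
  obtain i j :: 'd where "i \<noteq> j"
    using assms by (metis card_2_iff' obtain_subset_with_card_n UNIV_I)
  then obtain i j where ij: "h i < h j"
    using h by (metis injD linorder_neqE_nat)
  have "2 * K i \<le> B * K i ^ n"
    using B KB[of i] n self_le_power[of "K i" n] by (intro mult_mono) auto
  then have conv: "in_convex_position (stretched_point K ` {..<n})"
    using growth[OF ij] KB[of i] B by (intro in_convex_position_stretched[of K i j]) auto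
  have "inj (stretched_point K)"
    using KB[of i] B by (intro inj_stretched_point[of K i]) auto
  then have "card (stretched_point K ` {..<n}) = n"
    by (metis card_image card_lessThan inj_on_subset subset_UNIV)
  then show "\<exists>S :: (real^'d) set. finite S \<and> card S = n \<and> in_convex_position S \<and>
              (\<forall>p :: real^'d. real (simplex_depth CARD('d) S p)
                 \<le> (real n / real (CARD('d) + 1)) ^ (CARD('d) + 1) + 2 * real CARD('d) * real n ^ CARD('d))"
    using conv simplex_depth_stretched_le[of K h n] KB growth h
    by (intro exI[of _ "stretched_point K ` {..<n}"]) (auto simp: B_def)
qed

end
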